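(* Let $R$ be a semi-nil clean ring which has only finitely many non-central nilpotent elements. Then $R$ is periodic.
   Context: Rings are associative with identity, not necessarily commutative. An element $x$ of a ring $R$ is periodic if there exist two different positive integers $m\neq n$ with $x^m=x^n$; a ring is periodic if all its elements are periodic. A ring is semi-nil clean if each of its elements is the sum of a periodic element and a nilpotent element (no commutation required). *)

theory Defs
  imports "HOL-Algebra.Ring"
begin

text \<open>
  Rings are those of the locale \<^locale>\<open>ring\<close>: associative with identity, not necessarily
  commutative, and possibly zero. The predicates on elements do not include membership in
  the carrier.
\<close>

definition nilpotent_elt :: "('a, 'b) ring_scheme \<Rightarrow> 'a \<Rightarrow> bool" where
  "nilpotent_elt R x \<longleftrightarrow> (\<exists>n::nat. n > 0 \<and> x [^]\<^bsub>R\<^esub> n = \<zero>\<^bsub>R\<^esub>)"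

definition central_elt :: "('a, 'b) ring_scheme \<Rightarrow> 'a \<Rightarrow> bool" where
  "central_elt R x \<longleftrightarrow> (\<forall>y\<in>carrier R. x \<otimes>\<^bsub>R\<^esub> y = y \<otimes>\<^bsub>R\<^esub> x)"

definition periodic_elt :: "('a, 'b) ring_scheme \<Rightarrow> 'a \<Rightarrow> bool" where
  "periodic_elt R x \<longleftrightarrow>
     (\<exists>m n::nat. m > 0 \<and> n > 0 \<and> m \<noteq> n \<and> x [^]\<^bsub>R\<^esub> m = x [^]\<^bsub>R\<^esub> n)"

definition periodic_ring :: "('a, 'b) ring_scheme \<Rightarrow> bool" where
  "periodic_ring R \<longleftrightarrow> ring R \<and> (\<forall>x\<in>carrier R. periodic_elt R x)"

definition semi_nil_clean_ring :: "('a, 'b) ring_scheme \<Rightarrow> bool" where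
  "semi_nil_clean_ring R \<longleftrightarrow> ring R \<and>
     (\<forall>x\<in>carrier R. \<exists>p\<in>carrier R. \<exists>q\<in>carrier R.
        periodic_elt R p \<and> nilpotent_elt R q \<and> x = p \<oplus>\<^bsub>R\<^esub> q)"

end

theory Submission
  imports Defs
begin

text \<open>
  If all nilpotent elements are central, then the nilpotent part of each decomposition commutes
  with the periodic part. Decomposing \<open>1 + 1\<close> shows that the characteristic \<open>M\<close> is
  positive, and commuting elements whose difference is nilpotent then have a common power
  \<open>M^j\<close>, so every element is periodic.

  Otherwise there are only finitely many nilpotent elements at all, because adding a central
  nilpotent element to a non-central one gives a non-central nilpotent element. The elements \<open>a\<close>
  with \<open>aR\<close> finite form a two-sided ideal, and a finite index argument shows that it contains
  all nilpotent elements. Hence each \<open>x\<close> satisfies \<open>x^n - x^m = y\<close> with \<open>m < n\<close> and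
  \<open>yR\<close> finite. Since all \<open>x^(m + t(n - m)) - x^m\<close> lie in \<open>yR\<close>, two powers of \<open>x\<close> agree.
\<close>

section \<open>Periodic elements and their powers\<close>

lemma periodic_eltE:
  assumes "periodic_elt R p"
  obtains m n :: nat where "0 < m" "m < n" "p [^]\<^bsub>R\<^esub> n = p [^]\<^bsub>R\<^esub> m"
  using assms unfolding periodic_elt_def by (metis linorder_neqE_nat)

context ring
begin

lemma periodic_elt_of_pow:
  assumes "x \<in> carrier R" "0 < k" "periodic_elt R (x [^] (k::nat))"
  shows "periodic_elt R x"
proof -
  obtain m n :: nat where "0 < m" "m < n" "(x [^] k) [^] n = (x [^] k) [^] m"
    using assms(3) by (rule periodic_eltE)
  then show ?thesis
    using assms unfolding periodic_elt_def
    by (intro exI[of _ "k * m"] exI[of _ "k * n"]) (auto simp: nat_pow_pow)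
qed

lemma pow_periodic_elt:
  assumes "x \<in> carrier R" "periodic_elt R x"
  shows "periodic_elt R (x [^] (k::nat))"
proof -
  obtain m n :: nat where "0 < m" "m < n" "x [^] n = x [^] m"
    using assms(2) by (rule periodic_eltE)
  moreover have "(x [^] k) [^] n = (x [^] n) [^] k" "(x [^] k) [^] m = (x [^] m) [^] k"
    using assms(1) by (simp_all add: nat_pow_pow mult.commute)
  ultimately show ?thesis unfolding periodic_elt_def by (metis less_trans nat_less_le)
qed

section \<open>Powers of sums of commuting elements\<close>

text \<open>The binomial expansion cut off after its linear term, by induction on the exponent. The
  linear term stands alone because its coefficient will later vanish in the ring; \<open>w\<close>
  commutes with \<open>z\<close> so that the remainder inherits nilpotency from
  \<open>z\<close>.\<close>

lemma pow_add_second_order: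
  assumes v: "v \<in> carrier R" and z: "z \<in> carrier R" and vz: "v \<otimes> z = z \<otimes> v"
  shows "\<exists>w\<in>carrier R. w \<otimes> z = z \<otimes> w \<and>
    (v \<oplus> z) [^] Suc n = v [^] Suc n \<oplus> [Suc n] \<cdot> (v [^] n \<otimes> z) \<oplus> z \<otimes> z \<otimes> w"
proof (induction n)
  case 0
  then show ?case using v z by (intro bexI[of _ \<zero>]) auto
next
  case (Suc n)
  then obtain w where w: "w \<in> carrier R" "w \<otimes> z = z \<otimes> w"
    and e: "(v \<oplus> z) [^] Suc n = v [^] Suc n \<oplus> [Suc n] \<cdot> (v [^] n \<otimes> z) \<oplus> z \<otimes> z \<otimes> w"
    by auto
  define b where "b = [Suc n] \<cdot> (v [^] n)"
  define a where "a = v [^] Suc n"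
  have bc: "b \<in> carrier R" and ac: "a \<in> carrier R" using v by (auto simp: b_def a_def)
  have vnz: "v [^] k \<otimes> z = z \<otimes> v [^] k" for k :: nat
    using group_commutes_pow vz v z by blast
  have bz: "b \<otimes> z = z \<otimes> b" unfolding b_def
    using vnz v z by (simp only: add_pow_ldistr add_pow_rdistr nat_pow_closed)
  have bv: "b \<otimes> v = [Suc n] \<cdot> a" unfolding b_def a_def
    using v by (simp add: add_pow_ldistr del: add.nat_pow_Suc)
  have b': "[Suc n] \<cdot> (v [^] n \<otimes> z) = b \<otimes> z"
    unfolding b_def using v z by (simp only: add_pow_ldistr nat_pow_closed)
  have bzv: "b \<otimes> z \<otimes> v = [Suc n] \<cdot> a \<otimes> z"
    using bv vz bc v z by (metis m_assoc)
  have bzz: "b \<otimes> z \<otimes> z = z \<otimes> z \<otimes> b"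
    using bz bc z by (metis m_assoc)
  have top: "[Suc (Suc n)] \<cdot> (a \<otimes> z) = [Suc n] \<cdot> a \<otimes> z \<oplus> a \<otimes> z"
    using ac z by (simp add: add_pow_ldistr del: add.nat_pow_Suc)
                  (simp add: add_pow_ldistr)
  \<comment> \<open>After multiplying by \<open>v \<oplus> z\<close>, the products
    \<open>a \<otimes> z\<close> and \<open>b \<otimes> z \<otimes> v\<close> make up the new linear
    term. The witness \<open>w'\<close> collects the remaining products other than
    \<open>a \<otimes> v\<close>, with the factor \<open>z \<otimes> z\<close> pulled out to the
    left.\<close>
  define w' where "w' = b \<oplus> w \<otimes> v \<oplus> w \<otimes> z"
  have w'c: "w' \<in> carrier R" using bc w v z by (simp add: w'_def)
  have wvz: "w \<otimes> v \<otimes> z = z \<otimes> (w \<otimes> v)" using vz w v z by (metis m_assoc)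
  have wzz: "w \<otimes> z \<otimes> z = z \<otimes> (w \<otimes> z)" using w z by (metis m_assoc)
  have w'z: "w' \<otimes> z = z \<otimes> w'"
    unfolding w'_def using bc w v z bz wvz wzz by (simp add: l_distr r_distr)
  have "(v \<oplus> z) [^] Suc (Suc n) = (a \<oplus> b \<otimes> z \<oplus> z \<otimes> z \<otimes> w) \<otimes> (v \<oplus> z)"
    using e b' by (simp add: a_def)
  also have "\<dots> = a \<otimes> v \<oplus> a \<otimes> z \<oplus> (b \<otimes> z \<otimes> v \<oplus> b \<otimes> z \<otimes> z)
      \<oplus> (z \<otimes> z \<otimes> (w \<otimes> v) \<oplus> z \<otimes> z \<otimes> (w \<otimes> z))"
    using ac bc v z w(1) by (simp add: l_distr r_distr m_assoc a_ac)
  also have "\<dots> = a \<otimes> v \<oplus> ([Suc n] \<cdot> a \<otimes> z \<oplus> a \<otimes> z) \<oplus> z \<otimes> z \<otimes> w'"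
    unfolding bzv bzz w'_def using ac bc v z w(1)
    by (simp add: r_distr a_ac del: add.nat_pow_Suc)
  finally have "(v \<oplus> z) [^] Suc (Suc n) =
      v [^] Suc (Suc n) \<oplus> [Suc (Suc n)] \<cdot> (v [^] Suc n \<otimes> z) \<oplus> z \<otimes> z \<otimes> w'"
    unfolding top[symmetric] by (simp add: a_def)
  with w'c w'z show ?case by blast
qed

lemma pow_add_first_order:
  assumes v: "v \<in> carrier R" and z: "z \<in> carrier R" and vz: "v \<otimes> z = z \<otimes> v"
  shows "\<exists>c\<in>carrier R. c \<otimes> z = z \<otimes> c \<and> (v \<oplus> z) [^] (n::nat) = v [^] n \<oplus> z \<otimes> c"
\<comment> \<open>The second-order expansion starts at exponent 1, so exponent 0 takes the witness
  zero. Otherwise the linear and quadratic terms merge into one multiple of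
  \<open>z\<close>.\<close>
proof (cases n)
  case 0
  then show ?thesis using z by (intro bexI[of _ \<zero>]) auto
next
  case (Suc k)
  obtain w where w: "w \<in> carrier R" "w \<otimes> z = z \<otimes> w"
    and e: "(v \<oplus> z) [^] Suc k = v [^] Suc k \<oplus> [Suc k] \<cdot> (v [^] k \<otimes> z) \<oplus> z \<otimes> z \<otimes> w"
    using pow_add_second_order[OF assms] by blast
  define b where "b = [Suc k] \<cdot> (v [^] k)"
  have bc: "b \<in> carrier R" using v by (auto simp: b_def)
  have vnz: "v [^] k \<otimes> z = z \<otimes> v [^] k"
    using group_commutes_pow vz v z by blast
  have bz: "b \<otimes> z = z \<otimes> b" unfolding b_def
    using vnz v z by (simp only: add_pow_ldistr add_pow_rdistr nat_pow_closed)
  have b': "[Suc k] \<cdot> (v [^] k \<otimes> z) = z \<otimes> b"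
    unfolding bz[symmetric] unfolding b_def using v z by (simp only: add_pow_ldistr nat_pow_closed)
  have "(b \<oplus> z \<otimes> w) \<otimes> z = z \<otimes> (b \<oplus> z \<otimes> w)"
    using bz w z bc by (simp add: l_distr r_distr m_assoc)
  moreover have "(v \<oplus> z) [^] n = v [^] n \<oplus> z \<otimes> (b \<oplus> z \<otimes> w)"
    using e w z bc v unfolding Suc b' by (simp add: r_distr m_assoc a_assoc)
  ultimately show ?thesis using bc w z by blast
qed

lemma nilpotent_elt_mult_commute:
  assumes "z \<in> carrier R" "c \<in> carrier R" "c \<otimes> z = z \<otimes> c" "nilpotent_elt R z"
  shows "nilpotent_elt R (z \<otimes> c)"
  using assms unfolding nilpotent_elt_def by (metis pow_mult_distrib l_null nat_pow_closed)

lemma nilpotent_elt_of_pow: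
  assumes "x \<in> carrier R" "0 < k" "nilpotent_elt R (x [^] (k::nat))"
  shows "nilpotent_elt R x"
  using assms unfolding nilpotent_elt_def by (metis nat_pow_pow nat_0_less_mult_iff)

text \<open>Once \<open>q [^] n\<close> is zero, the first-order expansion reduces the
  \<open>n\<close>-th power of the sum to \<open>z \<otimes> c\<close>, a commuting multiple of the
  nilpotent \<open>z\<close>.\<close>

lemma nilpotent_elt_add_commute:
  assumes "q \<in> carrier R" "z \<in> carrier R" "q \<otimes> z = z \<otimes> q"
    and "nilpotent_elt R q" "nilpotent_elt R z"
  shows "nilpotent_elt R (q \<oplus> z)"
proof -
  obtain n :: nat where n: "0 < n" "q [^] n = \<zero>"
    using assms(4) unfolding nilpotent_elt_def by auto
  obtain c where "c \<in> carrier R" "c \<otimes> z = z \<otimes> c" "(q \<oplus> z) [^] n = q [^] n \<oplus> z \<otimes> c"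
    using pow_add_first_order[OF assms(1-3)] by blast
  then show ?thesis
    using n assms nilpotent_elt_mult_commute[of z c] nilpotent_elt_of_pow[of "q \<oplus> z" n] by simp
qed

section \<open>Common powers in positive characteristic\<close>

text \<open>Raising to the power \<open>M\<close> kills the linear term of the expansion, so the
  \<open>M\<close>-th powers differ by \<open>z \<otimes> z \<otimes> w\<close>, for which half the
  nilpotency exponent suffices. After \<open>j\<close> rounds the difference is zero.\<close>

lemma common_pow_if_diff_nilpotent:
  assumes "0 < (M::nat)" "[M] \<cdot> \<one> = \<zero>"
    and "v \<in> carrier R" "z \<in> carrier R" "v \<otimes> z = z \<otimes> v"
    and "z [^] ((2::nat) ^ j) = \<zero>"
  shows "(v \<oplus> z) [^] (M ^ j) = v [^] (M ^ j)"
  using assms(3-)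
proof (induction j arbitrary: v z)
  case 0
  then show ?case by simp
next
  case (Suc j)
  note v = Suc.prems(1) and z = Suc.prems(2)
  obtain n where n: "M = Suc n" using assms(1) gr0_implies_Suc by blast
  obtain w where w: "w \<in> carrier R" "w \<otimes> z = z \<otimes> w"
    and e: "(v \<oplus> z) [^] M = v [^] M \<oplus> [M] \<cdot> (v [^] n \<otimes> z) \<oplus> z \<otimes> z \<otimes> w"
    using pow_add_second_order[OF Suc.prems(1-3)] unfolding n by blast
  have "[M] \<cdot> (v [^] n \<otimes> z) = ([M] \<cdot> \<one>) \<otimes> (v [^] n \<otimes> z)"
    using v z by (simp add: add_pow_ldistr)
  also have "\<dots> = \<zero>" using assms(2) v z by simp
  finally have e: "(v \<oplus> z) [^] M = v [^] M \<oplus> z \<otimes> z \<otimes> w"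
    using e v z w by simp
  have zzc: "z \<otimes> z \<otimes> w \<in> carrier R" using z w by simp
  \<comment> \<open>The expansion does not say that \<open>w\<close> commutes with \<open>v\<close>.
    Writing \<open>z \<otimes> z \<otimes> w\<close> as a difference of two \<open>M\<close>-th
    powers gives the commutation that the induction hypothesis asks for.\<close>
  define u where "u = (v \<oplus> z) [^] M"
  have zu: "z \<otimes> z \<otimes> w = u \<ominus> v [^] M"
    unfolding u_def e using v zzc a_comm[of "v [^] M \<oplus> z \<otimes> z \<otimes> w" "\<ominus> (v [^] M)"]
    by (simp add: a_minus_def r_neg1)
  have "(v \<oplus> z) \<otimes> v = v \<otimes> (v \<oplus> z)"
    using v z Suc.prems(3) by (simp add: l_distr r_distr)
  then have "(v \<oplus> z) [^] M \<otimes> v = v \<otimes> (v \<oplus> z) [^] M"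
    using group_commutes_pow v z by simp
  then have "v [^] M \<otimes> u = u \<otimes> v [^] M"
    unfolding u_def using group_commutes_pow[of v "(v \<oplus> z) [^] M" M] v z by simp
  then have comm: "v [^] M \<otimes> (z \<otimes> z \<otimes> w) = z \<otimes> z \<otimes> w \<otimes> v [^] M"
    unfolding zu using v z by (simp add: u_def a_minus_def l_distr r_distr l_minus r_minus)
  have "w \<otimes> (z \<otimes> z) = z \<otimes> z \<otimes> w"
    using w z by (metis m_assoc)
  then have "(z \<otimes> z \<otimes> w) [^] ((2::nat) ^ j) = (z \<otimes> z) [^] ((2::nat) ^ j) \<otimes> w [^] ((2::nat) ^ j)"
    using pow_mult_distrib[of "z \<otimes> z" w] w z by simp
  also have "(z \<otimes> z) [^] ((2::nat) ^ j) = z [^] ((2::nat) ^ Suc j)"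
    using z nat_pow_pow[of z 2 "2 ^ j"] by (simp add: numeral_2_eq_2)
  finally have "(z \<otimes> z \<otimes> w) [^] ((2::nat) ^ j) = \<zero>"
    using Suc.prems(4) w by simp
  from Suc.IH[OF _ zzc comm this] have "((v \<oplus> z) [^] M) [^] (M ^ j) = (v [^] M) [^] (M ^ j)"
    using v e by simp
  then show ?case using v z by (simp add: nat_pow_pow)
qed

text \<open>Provides the exponent in the shape used by the inductions that square the
  element.\<close>

lemma nilpotent_elt_two_pow:
  assumes "z \<in> carrier R" "nilpotent_elt R z"
  shows "\<exists>j. z [^] ((2::nat) ^ j) = \<zero>"
proof -
  obtain n :: nat where n: "z [^] n = \<zero>" using assms unfolding nilpotent_elt_def by auto
  have "n \<le> 2 ^ n" by (simp add: less_imp_le)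
  then have "z [^] ((2::nat) ^ n) = z [^] n \<otimes> z [^] (2 ^ n - n)"
    using assms(1) nat_pow_mult[of z n "2 ^ n - n"] by simp
  then show ?thesis using n assms(1) by auto
qed

section \<open>Positivity of the characteristic\<close>

lemma two_pow_eq_add_pow: "(\<one> \<oplus> \<one>) [^] (n::nat) = [((2::nat) ^ n)] \<cdot> \<one>"
proof (induction n)
  case (Suc n)
  then show ?case
    by (simp add: r_distr mult_2 add.nat_pow_mult[symmetric])
qed simp

lemma add_pow_one_pow: "([(D::nat)] \<cdot> \<one>) [^] (k::nat) = [(D ^ k)] \<cdot> \<one>"
proof (induction k)
  case (Suc k)
  have "([(D ^ k)] \<cdot> \<one>) \<otimes> ([D] \<cdot> \<one>) = [D] \<cdot> ([(D ^ k)] \<cdot> \<one>)"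
    by (simp add: add_pow_rdistr)
  also have "\<dots> = [(D ^ Suc k)] \<cdot> \<one>"
    by (simp add: add.nat_pow_pow mult.commute)
  finally show ?case using Suc by simp
qed simp

text \<open>Decompose 2 as \<open>p \<oplus> q\<close>; since 2 is central, \<open>p\<close> and
  \<open>q\<close> commute. If the powers of \<open>p\<close> with exponents \<open>m < n\<close>
  agree, then \<open>2 ^ n - 2 ^ m\<close> becomes a commuting multiple of \<open>q\<close> in the
  ring, hence nilpotent, so a power of this integer annihilates 1.\<close>

lemma semi_nil_clean_pos_char:
  assumes "semi_nil_clean_ring R"
  shows "\<exists>M::nat. 0 < M \<and> [M] \<cdot> \<one> = \<zero>"
proof -
  let ?t = "\<one> \<oplus> \<one>"
  obtain p q where p: "p \<in> carrier R" "periodic_elt R p"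
    and q: "q \<in> carrier R" "nilpotent_elt R q" and t: "?t = p \<oplus> q"
    using assms unfolding semi_nil_clean_ring_def by (metis one_closed add.m_closed)
  have tp: "?t \<otimes> q = q \<otimes> ?t" using q by (simp add: l_distr r_distr)
  have pq: "p \<otimes> q = q \<otimes> p"
    using tp p(1) q(1) unfolding t by (simp add: l_distr r_distr)
  obtain m n :: nat where mn: "0 < m" "m < n" "p [^] n = p [^] m"
    using p(2) by (rule periodic_eltE)
  obtain c where c: "c \<in> carrier R" "c \<otimes> q = q \<otimes> c" "?t [^] n = p [^] n \<oplus> q \<otimes> c"
    using pow_add_first_order[OF p(1) q(1) pq] unfolding t by blast
  obtain d where d: "d \<in> carrier R" "d \<otimes> q = q \<otimes> d" "?t [^] m = p [^] m \<oplus> q \<otimes> d"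
    using pow_add_first_order[OF p(1) q(1) pq] unfolding t by blast
  \<comment> \<open>As \<open>m < n\<close>, the natural subtraction does not truncate and
    \<open>D\<close> is positive, hence so is \<open>D ^ k\<close>.\<close>
  define D :: nat where "D = 2 ^ n - 2 ^ m"
  have lt: "(2::nat) ^ m < 2 ^ n" using mn by simp
  then have "[((2::nat) ^ n)] \<cdot> \<one> = [D] \<cdot> \<one> \<oplus> [((2::nat) ^ m)] \<cdot> \<one>"
    unfolding D_def by (simp add: add.nat_pow_mult)
  then have "?t [^] n = [D] \<cdot> \<one> \<oplus> ?t [^] m" by (simp only: two_pow_eq_add_pow)
  then have "p [^] m \<oplus> q \<otimes> c = p [^] m \<oplus> ([D] \<cdot> \<one> \<oplus> q \<otimes> d)"
    using c(1,3) d(1,3) mn(3) p(1) q(1) by (simp add: a_ac)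
  then have "q \<otimes> c = [D] \<cdot> \<one> \<oplus> q \<otimes> d"
    using c(1) d(1) p(1) q(1) by simp
  then have "q \<otimes> c \<ominus> q \<otimes> d = [D] \<cdot> \<one>"
    using c(1) d(1) q(1) by (simp add: a_minus_def a_assoc r_neg)
  then have D: "q \<otimes> (c \<ominus> d) = [D] \<cdot> \<one>"
    using c(1) d(1) q(1) by (simp add: a_minus_def r_distr r_minus)
  have "(c \<ominus> d) \<otimes> q = q \<otimes> (c \<ominus> d)"
    using c d q(1) by (simp add: a_minus_def l_distr r_distr r_minus l_minus)
  then have "nilpotent_elt R ([D] \<cdot> \<one>)"
    using nilpotent_elt_mult_commute[of q "c \<ominus> d"] q c(1) d(1) D by simp
  then obtain k :: nat where "[(D ^ k)] \<cdot> \<one> = \<zero>"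
    unfolding nilpotent_elt_def add_pow_one_pow by blast
  then show ?thesis using lt by (intro exI[of _ "D ^ k"]) (simp add: D_def)
qed

section \<open>Finiteness of the right multiples of a nilpotent element\<close>

text \<open>An index argument: the kernel of \<open>f\<close> has finitely many cosets in
  \<open>H\<close>, one for each value of \<open>f\<close>, and \<open>g\<close> maps each coset
  into a translate of its finite image of the kernel.\<close>

lemma finite_image_if_finite_image_kernel:
  assumes H: "H \<subseteq> carrier R" "\<And>a b. a \<in> H \<Longrightarrow> b \<in> H \<Longrightarrow> a \<ominus> b \<in> H"
    and f: "\<And>a. a \<in> H \<Longrightarrow> f a \<in> carrier R"
      "\<And>a b. a \<in> H \<Longrightarrow> b \<in> H \<Longrightarrow> f (a \<ominus> b) = f a \<ominus> f b"
    and g: "\<And>a. a \<in> H \<Longrightarrow> g a \<in> carrier R"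
      "\<And>a b. a \<in> H \<Longrightarrow> b \<in> H \<Longrightarrow> g (a \<ominus> b) = g a \<ominus> g b"
    and fin: "finite (f ` H)" "finite (g ` {h \<in> H. f h = \<zero>})"
  shows "finite (g ` H)"
proof -
  let ?s = "inv_into H f"
  \<comment> \<open>The section \<open>?s\<close> picks one coset representative per value of
    \<open>f\<close>; \<open>g h\<close> is recovered from \<open>f h\<close> and the value of
    \<open>g\<close> at \<open>h\<close> minus its representative.\<close>
  have "g ` H \<subseteq> (\<lambda>(a, v). a \<oplus> g (?s v)) ` (g ` {h \<in> H. f h = \<zero>} \<times> f ` H)"
  proof
    fix y assume "y \<in> g ` H"
    then obtain h where h: "h \<in> H" "y = g h" by blast
    let ?r = "?s (f h)"
    have r: "?r \<in> H" "f ?r = f h" using h by (auto intro: inv_into_into f_inv_into_f)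
    have "f (h \<ominus> ?r) = \<zero>" using f h r by (simp add: a_minus_def r_neg)
    then have "h \<ominus> ?r \<in> {h \<in> H. f h = \<zero>}" using H(2) h r by simp
    moreover have "y = g (h \<ominus> ?r) \<oplus> g ?r"
      using g h r by (simp add: a_minus_def a_assoc l_neg)
    ultimately show "y \<in> (\<lambda>(a, v). a \<oplus> g (?s v)) ` (g ` {h \<in> H. f h = \<zero>} \<times> f ` H)"
      using h(1) by (intro image_eqI[of _ _ "(g (h \<ominus> ?r), f h)"]) auto
  qed
  then show ?thesis using fin by (meson finite_SigmaI finite_imageI finite_subset)
qed

lemma diff_mult_distribs:
  assumes "a \<in> carrier R" "b \<in> carrier R" "c \<in> carrier R"
  shows "c \<otimes> (a \<ominus> b) = c \<otimes> a \<ominus> c \<otimes> b" "(a \<ominus> b) \<otimes> c = a \<otimes> c \<ominus> b \<otimes> c"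
  using assms by (auto simp: a_minus_def l_distr r_distr l_minus r_minus)

text \<open>On the right annihilator \<open>A\<close> of \<open>q \<otimes> q\<close>, the elements
  \<open>q \<otimes> r \<otimes> q\<close> square to zero; where they vanish,
  \<open>q \<otimes> r\<close> squares to zero. Both sets of values are finite, as they consist of
  nilpotents, and two index arguments lift this to all of the ring.\<close>

lemma finite_mult_image_if_square:
  assumes q: "q \<in> carrier R" and N: "finite {x \<in> carrier R. nilpotent_elt R x}"
    and fin: "finite ((\<lambda>r. q \<otimes> q \<otimes> r) ` carrier R)"
  shows "finite ((\<lambda>r. q \<otimes> r) ` carrier R)"
proof -
  define A where "A = {r \<in> carrier R. q \<otimes> q \<otimes> r = \<zero>}"
  have A: "A \<subseteq> carrier R" "\<And>a b. a \<in> A \<Longrightarrow> b \<in> A \<Longrightarrow> a \<ominus> b \<in> A"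
    using q by (auto simp: A_def diff_mult_distribs) (simp add: a_minus_def)
  have sq: "nilpotent_elt R y" if "y \<in> carrier R" "y \<otimes> y = \<zero>" for y
    using that unfolding nilpotent_elt_def by (intro exI[of _ 2]) (simp add: numeral_2_eq_2)
  have "nilpotent_elt R (q \<otimes> r \<otimes> q)" if "r \<in> A" for r
  proof (rule sq)
    have r: "r \<in> carrier R" "q \<otimes> q \<otimes> r = \<zero>" using that by (auto simp: A_def)
    have "q \<otimes> r \<otimes> q \<otimes> (q \<otimes> r \<otimes> q) = q \<otimes> r \<otimes> (q \<otimes> q \<otimes> r) \<otimes> q"
      using r(1) q by (simp add: m_assoc)
    then show "q \<otimes> r \<otimes> q \<otimes> (q \<otimes> r \<otimes> q) = \<zero>" using r q by simp
  qed (use that A q in auto)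
  then have 1: "finite ((\<lambda>r. q \<otimes> r \<otimes> q) ` A)"
    by (intro finite_subset[OF _ N]) (use A q in auto)
  have "nilpotent_elt R (q \<otimes> r)" if "r \<in> A" "q \<otimes> r \<otimes> q = \<zero>" for r
  proof (rule sq)
    have r: "r \<in> carrier R" using that A by auto
    have "q \<otimes> r \<otimes> (q \<otimes> r) = (q \<otimes> r \<otimes> q) \<otimes> r" using r q by (simp add: m_assoc)
    then show "q \<otimes> r \<otimes> (q \<otimes> r) = \<zero>" using that(2) r q by simp
  qed (use that A q in auto)
  then have "finite ((\<lambda>r. q \<otimes> r) ` {r \<in> A. q \<otimes> r \<otimes> q = \<zero>})"
    by (intro finite_subset[OF _ N]) (use A q in auto)
  \<comment> \<open>Index argument on \<open>A\<close>, with \<open>f\<close> sending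
    \<open>r\<close> to \<open>q \<otimes> r \<otimes> q\<close>.\<close>
  then have "finite ((\<lambda>r. q \<otimes> r) ` A)"
    by (intro finite_image_if_finite_image_kernel[OF A _ _ _ _ 1])
       (use q in \<open>simp_all add: A_def diff_mult_distribs\<close>)
  \<comment> \<open>Index argument on the whole ring: \<open>f\<close> now sends \<open>r\<close> to
    \<open>q \<otimes> q \<otimes> r\<close>, with kernel \<open>A\<close>.\<close>
  then show ?thesis
    by (intro finite_image_if_finite_image_kernel[OF subset_refl _ _ _ _ _ fin])
       (use q in \<open>simp_all add: A_def diff_mult_distribs\<close>)
qed

text \<open>Induction on the number of squarings that reach zero: \<open>q \<otimes> q\<close> needs
  one fewer, and finiteness passes from it back to \<open>q\<close>.\<close>

lemma finite_mult_image_if_nilpotent: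
  assumes N: "finite {x \<in> carrier R. nilpotent_elt R x}"
    and "q \<in> carrier R" "nilpotent_elt R q"
  shows "finite ((\<lambda>r. q \<otimes> r) ` carrier R)"
proof -
  have "finite ((\<lambda>r. q \<otimes> r) ` carrier R)" if "q [^] ((2::nat) ^ j) = \<zero>" "q \<in> carrier R" for j q
    using that
  proof (induction j arbitrary: q)
    case 0
    then have "(\<lambda>r. q \<otimes> r) ` carrier R \<subseteq> {\<zero>}" by auto
    then show ?case by (rule finite_subset) simp
  next
    case (Suc j)
    have "(q \<otimes> q) [^] ((2::nat) ^ j) = q [^] ((2::nat) ^ Suc j)"
      using Suc.prems(2) nat_pow_pow[of q 2 "2 ^ j"] by (simp add: numeral_2_eq_2)
    then show ?case
      using Suc.IH[of "q \<otimes> q"] Suc.prems finite_mult_image_if_square[OF _ N, of q] by simp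
  qed
  then show ?thesis using nilpotent_elt_two_pow assms by blast
qed

section \<open>Powers modulo the ideal of elements with finitely many right multiples\<close>

text \<open>The closure properties of a two-sided ideal, modulo which powers are compared
  below.\<close>

lemma finite_mult_image_closed:
  assumes a: "a \<in> carrier R" "finite ((\<lambda>r. a \<otimes> r) ` carrier R)"
  shows "b \<in> carrier R \<Longrightarrow> finite ((\<lambda>r. b \<otimes> r) ` carrier R) \<Longrightarrow>
      finite ((\<lambda>r. (a \<oplus> b) \<otimes> r) ` carrier R)"
    and "b \<in> carrier R \<Longrightarrow> finite ((\<lambda>r. (b \<otimes> a) \<otimes> r) ` carrier R)"
    and "b \<in> carrier R \<Longrightarrow> finite ((\<lambda>r. (a \<otimes> b) \<otimes> r) ` carrier R)"
    and "finite ((\<lambda>r. (\<ominus> a) \<otimes> r) ` carrier R)"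
proof -
  show "finite ((\<lambda>r. (a \<oplus> b) \<otimes> r) ` carrier R)"
    if b: "b \<in> carrier R" "finite ((\<lambda>r. b \<otimes> r) ` carrier R)"
  proof (rule finite_subset)
    show "(\<lambda>r. (a \<oplus> b) \<otimes> r) ` carrier R \<subseteq>
      (\<lambda>(x, y). x \<oplus> y) ` ((\<lambda>r. a \<otimes> r) ` carrier R \<times> (\<lambda>r. b \<otimes> r) ` carrier R)"
      using a b by (auto simp: l_distr)
  qed (use a b in auto)
  show "finite ((\<lambda>r. (b \<otimes> a) \<otimes> r) ` carrier R)" if "b \<in> carrier R"
  proof (rule finite_subset)
    show "(\<lambda>r. (b \<otimes> a) \<otimes> r) ` carrier R \<subseteq> (\<lambda>x. b \<otimes> x) ` ((\<lambda>r. a \<otimes> r) ` carrier R)"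
      using a that by (auto simp: m_assoc)
  qed (use a in auto)
  show "finite ((\<lambda>r. (a \<otimes> b) \<otimes> r) ` carrier R)" if "b \<in> carrier R"
  proof (rule finite_subset)
    show "(\<lambda>r. (a \<otimes> b) \<otimes> r) ` carrier R \<subseteq> (\<lambda>r. a \<otimes> r) ` carrier R"
      using a that by (auto simp: m_assoc)
  qed (use a in auto)
  show "finite ((\<lambda>r. (\<ominus> a) \<otimes> r) ` carrier R)"
  proof (rule finite_subset)
    show "(\<lambda>r. (\<ominus> a) \<otimes> r) ` carrier R \<subseteq> (\<lambda>x. \<ominus> x) ` ((\<lambda>r. a \<otimes> r) ` carrier R)"
      using a by (auto simp: l_minus)
  qed (use a in auto)
qed

text \<open>Modulo the ideal, \<open>p \<oplus> q\<close> and \<open>p\<close> are congruent, hence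
  so are their powers.\<close>

lemma finite_mult_image_pow_diff:
  assumes p: "p \<in> carrier R" and q: "q \<in> carrier R" "finite ((\<lambda>r. q \<otimes> r) ` carrier R)"
  shows "\<exists>s\<in>carrier R. (p \<oplus> q) [^] (n::nat) = p [^] n \<oplus> s \<and> finite ((\<lambda>r. s \<otimes> r) ` carrier R)"
proof (induction n)
  case 0
  have "(\<lambda>r. \<zero> \<otimes> r) ` carrier R \<subseteq> {\<zero>}" by auto
  then have "finite ((\<lambda>r. \<zero> \<otimes> r) ` carrier R)" by (rule finite_subset) simp
  then show ?case by (intro bexI[of _ \<zero>]) auto
next
  case (Suc n)
  then obtain s where s: "s \<in> carrier R" "(p \<oplus> q) [^] n = p [^] n \<oplus> s"
    "finite ((\<lambda>r. s \<otimes> r) ` carrier R)" by blast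
  \<comment> \<open>The new error is a left multiple of \<open>q\<close> plus a right multiple of
    \<open>s\<close>, so both sides of the ideal property enter.\<close>
  have "(p \<oplus> q) [^] Suc n = p [^] Suc n \<oplus> (p [^] n \<otimes> q \<oplus> s \<otimes> (p \<oplus> q))"
    using p q s(1,2) by (simp add: l_distr r_distr a_ac)
  moreover have "finite ((\<lambda>r. (p [^] n \<otimes> q \<oplus> s \<otimes> (p \<oplus> q)) \<otimes> r) ` carrier R)"
    using finite_mult_image_closed(1)[OF _ finite_mult_image_closed(2)[OF q, of "p [^] n"] _
        finite_mult_image_closed(3)[OF s(1,3), of "p \<oplus> q"]] p q(1) s(1)
    by simp
  ultimately show ?case
    using p q(1) s(1) by (intro bexI[of _ "p [^] n \<otimes> q \<oplus> s \<otimes> (p \<oplus> q)"]) auto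
qed

text \<open>Pigeonhole: multiplication by \<open>x [^] d\<close> keeps the powers
  \<open>x [^] (m + t * d)\<close> inside the finite coset of \<open>x [^] m\<close> modulo the
  right ideal generated by \<open>y\<close>.\<close>

lemma periodic_elt_if_finite_mult_image:
  assumes x: "x \<in> carrier R" and y: "y \<in> carrier R" "finite ((\<lambda>r. y \<otimes> r) ` carrier R)"
    and mn: "0 < m" "m < n" "x [^] n = x [^] (m::nat) \<oplus> y"
  shows "periodic_elt R x"
proof -
  define d where "d = n - m"
  have d: "0 < d" "n = m + d" using mn by (auto simp: d_def)
  have *: "\<exists>r\<in>carrier R. x [^] (m + t * d) = x [^] m \<oplus> y \<otimes> r" for t
  proof (induction t)
    case 0
    then show ?case using x y by (intro bexI[of _ \<zero>]) auto
  next
    case (Suc t)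
    then obtain r where r: "r \<in> carrier R" "x [^] (m + t * d) = x [^] m \<oplus> y \<otimes> r" by blast
    have "x [^] (m + Suc t * d) = x [^] (m + t * d) \<otimes> x [^] d"
      using x by (simp add: nat_pow_mult add_ac)
    also have "\<dots> = x [^] n \<oplus> y \<otimes> r \<otimes> x [^] d"
      using r x y by (simp add: d(2) l_distr nat_pow_mult)
    also have "\<dots> = x [^] m \<oplus> y \<otimes> (\<one> \<oplus> r \<otimes> x [^] d)"
      using r x y by (simp add: mn(3) r_distr m_assoc a_assoc)
    finally show ?case using r x by blast
  qed
  have "range (\<lambda>t. x [^] (m + t * d)) \<subseteq> (\<lambda>z. x [^] m \<oplus> z) ` ((\<lambda>r. y \<otimes> r) ` carrier R)"
    using * by blast
  then have "finite (range (\<lambda>t. x [^] (m + t * d)))"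
    using y(2) finite_subset by blast
  then have "\<not> inj (\<lambda>t. x [^] (m + t * d))"
    using finite_imageD infinite_UNIV_nat by blast
  then obtain s t where "s \<noteq> t" "x [^] (m + s * d) = x [^] (m + t * d)"
    unfolding inj_def by blast
  then show ?thesis
    unfolding periodic_elt_def using d(1) mn(1)
    by (intro exI[of _ "m + s * d"] exI[of _ "m + t * d"]) auto
qed

section \<open>Sums of a periodic and a nilpotent element\<close>

text \<open>The sum shares a power with \<open>p\<close>; periodicity passes from \<open>p\<close>
  to that power and from there down to the sum.\<close>

lemma periodic_elt_add_commute:
  assumes "0 < (M::nat)" "[M] \<cdot> \<one> = \<zero>"
    and p: "p \<in> carrier R" "periodic_elt R p" and q: "q \<in> carrier R" "nilpotent_elt R q"
    and pq: "p \<otimes> q = q \<otimes> p"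
  shows "periodic_elt R (p \<oplus> q)"
proof -
  obtain j where "q [^] ((2::nat) ^ j) = \<zero>" using nilpotent_elt_two_pow q by blast
  then have "(p \<oplus> q) [^] (M ^ j) = p [^] (M ^ j)"
    using common_pow_if_diff_nilpotent assms by blast
  then show ?thesis
    using periodic_elt_of_pow[of "p \<oplus> q" "M ^ j"] pow_periodic_elt[OF p] p q assms(1) by simp
qed

text \<open>Modulo the ideal, the sum satisfies the same equality of powers as \<open>p\<close>, and
  the pigeonhole lemma applies to the error \<open>s \<oplus> \<ominus> s'\<close>.\<close>

lemma periodic_elt_add_finite_mult_image:
  assumes p: "p \<in> carrier R" "periodic_elt R p"
    and q: "q \<in> carrier R" "finite ((\<lambda>r. q \<otimes> r) ` carrier R)"
  shows "periodic_elt R (p \<oplus> q)"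
proof -
  obtain m n :: nat where mn: "0 < m" "m < n" "p [^] n = p [^] m"
    using p(2) by (rule periodic_eltE)
  obtain s where s: "s \<in> carrier R" "(p \<oplus> q) [^] n = p [^] n \<oplus> s"
    "finite ((\<lambda>r. s \<otimes> r) ` carrier R)"
    using finite_mult_image_pow_diff[OF p(1) q] by blast
  obtain s' where s': "s' \<in> carrier R" "(p \<oplus> q) [^] m = p [^] m \<oplus> s'"
    "finite ((\<lambda>r. s' \<otimes> r) ` carrier R)"
    using finite_mult_image_pow_diff[OF p(1) q] by blast
  have "(p \<oplus> q) [^] m \<oplus> (s \<oplus> \<ominus> s') = p [^] m \<oplus> (s' \<oplus> \<ominus> s') \<oplus> s"
    using s(1) s'(1) p(1) unfolding s'(2) by (simp add: a_ac)
  also have "\<dots> = (p \<oplus> q) [^] n"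
    using s(1) s'(1) p(1) unfolding s(2) mn(3) by (simp add: r_neg)
  finally have "(p \<oplus> q) [^] n = (p \<oplus> q) [^] m \<oplus> (s \<oplus> \<ominus> s')" by simp
  moreover have "finite ((\<lambda>r. (s \<oplus> \<ominus> s') \<otimes> r) ` carrier R)"
    using finite_mult_image_closed(1)[OF s(1,3) _ finite_mult_image_closed(4)[OF s'(1,3)]] s'(1)
    by simp
  ultimately show ?thesis
    using periodic_elt_if_finite_mult_image[of "p \<oplus> q" "s \<oplus> \<ominus> s'" m n] mn(1,2) s(1) s'(1) p(1) q(1)
    by simp
qed

text \<open>Translation by \<open>q\<close> embeds the central nilpotents into the non-central ones:
  if \<open>q \<oplus> z\<close> were central, \<open>q\<close> would be a difference of central
  elements.\<close>

lemma finite_nilpotent_if_noncentral: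
  assumes fin: "finite {x \<in> carrier R. nilpotent_elt R x \<and> \<not> central_elt R x}"
    and q: "q \<in> carrier R" "nilpotent_elt R q" "\<not> central_elt R q"
  shows "finite {x \<in> carrier R. nilpotent_elt R x}"
proof -
  let ?C = "{x \<in> carrier R. nilpotent_elt R x \<and> central_elt R x}"
  have "(\<lambda>z. q \<oplus> z) ` ?C \<subseteq> {x \<in> carrier R. nilpotent_elt R x \<and> \<not> central_elt R x}"
  proof safe
    fix z assume z: "z \<in> carrier R" "nilpotent_elt R z" "central_elt R z"
    show "q \<oplus> z \<in> carrier R" using q z by simp
    show "nilpotent_elt R (q \<oplus> z)"
      using nilpotent_elt_add_commute q z unfolding central_elt_def by simp
    assume "central_elt R (q \<oplus> z)"
    then have "q \<otimes> y = y \<otimes> q" if "y \<in> carrier R" for y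
      using z q that unfolding central_elt_def by (simp add: l_distr r_distr)
    then show False using q(3) unfolding central_elt_def by blast
  qed
  moreover have "inj_on (\<lambda>z. q \<oplus> z) ?C" using q(1) by (auto intro: inj_onI)
  ultimately have "finite ?C" using fin finite_imageD finite_subset by meson
  moreover have "{x \<in> carrier R. nilpotent_elt R x} =
      ?C \<union> {x \<in> carrier R. nilpotent_elt R x \<and> \<not> central_elt R x}" by blast
  ultimately show ?thesis using fin by simp
qed

end

theorem theorem2p9:
  fixes R :: "('a, 'b) ring_scheme"
  assumes "semi_nil_clean_ring R"
    and "finite {x \<in> carrier R. nilpotent_elt R x \<and> \<not> central_elt R x}"
  shows "periodic_ring R"
proof -
  interpret ring R using assms(1) unfolding semi_nil_clean_ring_def by simp
  have "periodic_elt R x" if "x \<in> carrier R" for x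
  proof -
    obtain p q where p: "p \<in> carrier R" "periodic_elt R p"
      and q: "q \<in> carrier R" "nilpotent_elt R q" and x: "x = p \<oplus>\<^bsub>R\<^esub> q"
      using assms(1) \<open>x \<in> carrier R\<close> unfolding semi_nil_clean_ring_def by blast
    \<comment> \<open>The split is on the nilpotent part of this particular \<open>x\<close>: a
      central \<open>q\<close> commutes with \<open>p\<close>, while a non-central \<open>q\<close>
      forces finitely many nilpotents in the ring.\<close>
    show ?thesis
    proof (cases "central_elt R q")
      case True
      then have "p \<otimes>\<^bsub>R\<^esub> q = q \<otimes>\<^bsub>R\<^esub> p" using p unfolding central_elt_def by simp
      then show ?thesis
        using semi_nil_clean_pos_char[OF assms(1)] periodic_elt_add_commute p q x by blast
    next
      case False
      then show ?thesis
        using finite_nilpotent_if_noncentral[OF assms(2)] finite_mult_image_if_nilpotent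
          periodic_elt_add_finite_mult_image p q x by blast
    qed
  qed
  then show ?thesis unfolding periodic_ring_def using ring_axioms by blast
qed

end
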